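(* Let $\varphi\in\mathcal{S}_0(\mathfrak{F})$, with corresponding equivariant measurable field of states $\{\varphi_\xi\}_{\xi\in X}$ on $\mathcal{F}$. Then there exists a measurable set $F\subset X$ of full measure such that $\xi\in F$ implies $G_{\varphi_\xi}=G_\varphi$.
   Context: Setting. $\mathcal{F}$ is a separable unital $C^*$-algebra, $G$ a compact second countable group with a pointwise-norm continuous action $\gamma:g\in G\mapsto\gamma_g\in\mathrm{Aut}(\mathcal{F})$. The group $\mathbb{Z}^d$ acts on $\mathcal{F}$ by automorphisms $\{\alpha_x\}_{x\in\mathbb{Z}^d}$ with $\alpha_x\gamma_g=\gamma_g\alpha_x$ for all $x,g$. $(X,\nu)$ is a standard measure space based on a compact separable space $X$, with $\nu$ a Borel probability measure, and $\{T_x\}_{x\in\mathbb{Z}^d}$ is an ergodic measure preserving action of $\mathbb{Z}^d$ on $(X,\nu)$. $\mathfrak{F}:=\mathcal{F}\otimes L^\infty(X,\nu)$, whose elements $A$ are regarded as essentially bounded measurable functions $\xi\mapsto A(\xi)\in\mathcal{F}$. Put $\mathfrak{a}_x(A)(\xi):=\alpha_x(A(T_{-x}\xi))$ and $\mathfrak{g}_g:=\gamma_g\otimes\mathrm{id}_{L^\infty(X,\nu)}$. $\mathcal{S}_0(\mathfrak{F})$ is the set of $\mathfrak{a}$-invariant states on $\mathfrak{F}$ whose restriction to $I\otimes L^\infty(X,\nu)$ is normal. Each $\varphi\in\mathcal{S}_0(\mathfrak{F})$ has a decomposition $\varphi(A)=\int_X\varphi_\xi(A(\xi))\,\nu(d\xi)$,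 $A\in\mathfrak{F}$, with a weak-* measurable field of states $\{\varphi_\xi\}_{\xi\in X}$ on $\mathcal{F}$ which is equivariant: almost surely $\varphi_\xi\circ\alpha_x=\varphi_{T_{-x}\xi}$ simultaneously for all $x\in\mathbb{Z}^d$. Stabilizers: $G_\varphi:=\{g\in G\mid\varphi\circ\mathfrak{g}_g=\varphi\}$ and $G_{\varphi_\xi}:=\{g\in G\mid\varphi_\xi\circ\gamma_g=\varphi_\xi\}$. *)

theory Defs
  imports "HOL-Probability.Probability"
begin

section \<open>Unital C*-algebras\<close>

text \<open>The library has no complex normed spaces, so the complex scalar multiplication is added on
  top of a unital real Banach algebra. A separable algebra is one of sort
  \<open>{unital_cstar_algebra, second_countable_topology}\<close>; in a metric space, second countability and
  separability coincide.\<close>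

class unital_cstar_algebra = real_normed_algebra_1 + banach +
  fixes scaleC :: "complex \<Rightarrow> 'a \<Rightarrow> 'a"
    and star :: "'a \<Rightarrow> 'a"
  assumes scaleC_add_right: "scaleC c (a + b) = scaleC c a + scaleC c b"
    and scaleC_add_left: "scaleC (c + c') a = scaleC c a + scaleC c' a"
    and scaleC_scaleC: "scaleC c (scaleC c' a) = scaleC (c * c') a"
    and scaleC_of_real: "scaleC (complex_of_real r) a = scaleR r a"
    and mult_scaleC_left: "scaleC c a * b = scaleC c (a * b)"
    and mult_scaleC_right: "a * scaleC c b = scaleC c (a * b)"
    and norm_scaleC: "norm (scaleC c a) = cmod c * norm a"
    and star_add: "star (a + b) = star a + star b"
    and star_scaleC: "star (scaleC c a) = scaleC (cnj c) (star a)"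
    and star_mult: "star (a * b) = star b * star a"
    and star_star: "star (star a) = a"
    and cstar_identity: "norm (star a * a) = (norm a)\<^sup>2"

definition star_automorphism :: "('a::unital_cstar_algebra \<Rightarrow> 'a) \<Rightarrow> bool" where
  "star_automorphism \<theta> \<longleftrightarrow> bij \<theta> \<and>
     (\<forall>a b. \<theta> (a + b) = \<theta> a + \<theta> b) \<and>
     (\<forall>c a. \<theta> (scaleC c a) = scaleC c (\<theta> a)) \<and>
     (\<forall>a b. \<theta> (a * b) = \<theta> a * \<theta> b) \<and>
     (\<forall>a. \<theta> (star a) = star (\<theta> a))"

text \<open>A state is a positive linear functional of norm one; the norm is attained at the unit.\<close>

definition state :: "('a::unital_cstar_algebra \<Rightarrow> complex) \<Rightarrow> bool" where
  "state \<omega> \<longleftrightarrow>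
     (\<forall>a b. \<omega> (a + b) = \<omega> a + \<omega> b) \<and>
     (\<forall>c a. \<omega> (scaleC c a) = c * \<omega> a) \<and>
     (\<forall>a. \<omega> (star a * a) \<in> \<real>\<^sub>\<ge>\<^sub>0) \<and>
     (\<forall>a. cmod (\<omega> a) \<le> norm a) \<and> \<omega> 1 = 1"

text \<open>The class \<open>group_add\<close> is additive in notation only: the group need not be commutative.\<close>

definition action :: "('h::group_add \<Rightarrow> 'b \<Rightarrow> 'b) \<Rightarrow> bool" where
  "action \<beta> \<longleftrightarrow> \<beta> 0 = id \<and> (\<forall>g h. \<beta> (g + h) = \<beta> g \<circ> \<beta> h)"

definition automorphic_action :: "('h::group_add \<Rightarrow> 'a::unital_cstar_algebra \<Rightarrow> 'a) \<Rightarrow> bool" where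
  "automorphic_action \<beta> \<longleftrightarrow> action \<beta> \<and> (\<forall>g. star_automorphism (\<beta> g))"

section \<open>The measure space and its dynamics\<close>

definition standard_borel :: "'x measure \<Rightarrow> bool" where
  "standard_borel \<nu> \<longleftrightarrow> (\<exists>S. topspace S = space \<nu> \<and> completely_metrizable_space S \<and>
     second_countable S \<and> sets \<nu> = sigma_sets (space \<nu>) {U. openin S U})"

definition measure_preserving_action :: "'x measure \<Rightarrow> ('h::group_add \<Rightarrow> 'x \<Rightarrow> 'x) \<Rightarrow> bool" where
  "measure_preserving_action \<nu> T \<longleftrightarrow> action T \<and>
     (\<forall>x. T x \<in> measurable \<nu> \<nu> \<and> distr \<nu> \<nu> (T x) = \<nu>)"

definition ergodic_action :: "'x measure \<Rightarrow> ('h::group_add \<Rightarrow> 'x \<Rightarrow> 'x) \<Rightarrow> bool" where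
  "ergodic_action \<nu> T \<longleftrightarrow> measure_preserving_action \<nu> T \<and>
     (\<forall>E\<in>sets \<nu>. (\<forall>x. T x -` E \<inter> space \<nu> = E) \<longrightarrow> measure \<nu> E = 0 \<or> measure \<nu> E = 1)"

section \<open>The tensor product with the essentially bounded functions\<close>

text \<open>Elements of \<open>L\<^sup>\<infinity>\<close> spaces are represented by functions; that functions agreeing almost
  everywhere are identified is expressed by requiring functionals to respect almost everywhere
  equality.\<close>

definition Linf :: "'x measure \<Rightarrow> ('x \<Rightarrow> 'b::real_normed_vector) set" where
  "Linf \<nu> = {A \<in> borel_measurable \<nu>. \<exists>C. AE \<xi> in \<nu>. norm (A \<xi>) \<le> C}"

definition alg_tensor_Linf :: "'x measure \<Rightarrow> ('x \<Rightarrow> 'a::unital_cstar_algebra) set" where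
  "alg_tensor_Linf \<nu> = {A. \<exists>(n::nat) a f. (\<forall>i<n. f i \<in> Linf \<nu>) \<and>
     A = (\<lambda>\<xi>. \<Sum>i<n. scaleC (f i \<xi>) (a i))}"

text \<open>Since \<open>L\<^sup>\<infinity>\<close> is abelian, the C*-tensor product is unique; it is realised as the closure of the
  algebraic tensor product in the essential supremum norm of the bounded measurable
  algebra-valued functions. For an infinite-dimensional algebra it may be smaller than the set of
  all such functions.\<close>

definition tensor_Linf :: "'x measure \<Rightarrow> ('x \<Rightarrow> 'a::unital_cstar_algebra) set" where
  "tensor_Linf \<nu> = {A \<in> Linf \<nu>.
     \<forall>\<epsilon>>0. \<exists>B\<in>alg_tensor_Linf \<nu>. AE \<xi> in \<nu>. norm (A \<xi> - B \<xi>) \<le> \<epsilon>}"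

definition lift_shift ::
  "('h::group_add \<Rightarrow> 'a \<Rightarrow> 'a) \<Rightarrow> ('h \<Rightarrow> 'x \<Rightarrow> 'x) \<Rightarrow> 'h \<Rightarrow> ('x \<Rightarrow> 'a) \<Rightarrow> ('x \<Rightarrow> 'a)" where
  "lift_shift \<alpha> T x A = (\<lambda>\<xi>. \<alpha> x (A (T (- x) \<xi>)))"

text \<open>\<open>\<gamma>\<^sub>g \<otimes> id\<close>, acting pointwise on functions\<close>

definition lift_gauge :: "('g \<Rightarrow> 'a \<Rightarrow> 'a) \<Rightarrow> 'g \<Rightarrow> ('x \<Rightarrow> 'a) \<Rightarrow> ('x \<Rightarrow> 'a)" where
  "lift_gauge \<gamma> g A = (\<lambda>\<xi>. \<gamma> g (A \<xi>))"

definition tensor_state ::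
  "'x measure \<Rightarrow> (('x \<Rightarrow> 'a::unital_cstar_algebra) \<Rightarrow> complex) \<Rightarrow> bool" where
  "tensor_state \<nu> \<phi> \<longleftrightarrow>
     (\<forall>A\<in>tensor_Linf \<nu>. \<forall>B\<in>tensor_Linf \<nu>. (AE \<xi> in \<nu>. A \<xi> = B \<xi>) \<longrightarrow> \<phi> A = \<phi> B) \<and>
     (\<forall>A\<in>tensor_Linf \<nu>. \<forall>B\<in>tensor_Linf \<nu>. \<phi> (\<lambda>\<xi>. A \<xi> + B \<xi>) = \<phi> A + \<phi> B) \<and>
     (\<forall>c. \<forall>A\<in>tensor_Linf \<nu>. \<phi> (\<lambda>\<xi>. scaleC c (A \<xi>)) = c * \<phi> A) \<and>
     (\<forall>A\<in>tensor_Linf \<nu>. \<phi> (\<lambda>\<xi>. star (A \<xi>) * A \<xi>) \<in> \<real>\<^sub>\<ge>\<^sub>0) \<and>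
     (\<forall>A\<in>tensor_Linf \<nu>. \<forall>C. (AE \<xi> in \<nu>. norm (A \<xi>) \<le> C) \<longrightarrow> cmod (\<phi> A) \<le> C) \<and>
     \<phi> (\<lambda>\<xi>. 1) = 1"

text \<open>Normality of a positive functional on \<open>L\<^sup>\<infinity>\<close>: it preserves the least upper bound of every bounded
  upward directed set of positive elements, the order being the almost everywhere one.\<close>

definition Linf_pos :: "'x measure \<Rightarrow> ('x \<Rightarrow> real) set" where
  "Linf_pos \<nu> = {f \<in> Linf \<nu>. AE \<xi> in \<nu>. 0 \<le> f \<xi>}"

definition ae_le :: "'x measure \<Rightarrow> ('x \<Rightarrow> real) \<Rightarrow> ('x \<Rightarrow> real) \<Rightarrow> bool" where
  "ae_le \<nu> f h \<longleftrightarrow> (AE \<xi> in \<nu>. f \<xi> \<le> h \<xi>)"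

definition ae_lub :: "'x measure \<Rightarrow> ('x \<Rightarrow> real) set \<Rightarrow> ('x \<Rightarrow> real) \<Rightarrow> bool" where
  "ae_lub \<nu> D f \<longleftrightarrow> f \<in> Linf_pos \<nu> \<and> (\<forall>h\<in>D. ae_le \<nu> h f) \<and>
     (\<forall>u\<in>Linf_pos \<nu>. (\<forall>h\<in>D. ae_le \<nu> h u) \<longrightarrow> ae_le \<nu> f u)"

definition normal_on_Linf :: "'x measure \<Rightarrow> (('x \<Rightarrow> complex) \<Rightarrow> complex) \<Rightarrow> bool" where
  "normal_on_Linf \<nu> \<omega> \<longleftrightarrow>
     (\<forall>D f. D \<noteq> {} \<and> D \<subseteq> Linf_pos \<nu> \<and>
        (\<forall>h\<in>D. \<forall>k\<in>D. \<exists>l\<in>D. ae_le \<nu> h l \<and> ae_le \<nu> k l) \<and> ae_lub \<nu> D f \<longrightarrow>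
        Re (\<omega> (\<lambda>\<xi>. complex_of_real (f \<xi>))) =
          (SUP h\<in>D. Re (\<omega> (\<lambda>\<xi>. complex_of_real (h \<xi>)))))"

definition invariant_normal_states ::
  "'x measure \<Rightarrow> ('h::group_add \<Rightarrow> 'a::unital_cstar_algebra \<Rightarrow> 'a) \<Rightarrow> ('h \<Rightarrow> 'x \<Rightarrow> 'x)
    \<Rightarrow> (('x \<Rightarrow> 'a) \<Rightarrow> complex) set" where
  "invariant_normal_states \<nu> \<alpha> T = {\<phi>. tensor_state \<nu> \<phi> \<and>
     (\<forall>x. \<forall>A\<in>tensor_Linf \<nu>. \<phi> (lift_shift \<alpha> T x A) = \<phi> A) \<and>
     normal_on_Linf \<nu> (\<lambda>f. \<phi> (\<lambda>\<xi>. scaleC (f \<xi>) 1))}"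

section \<open>Fields of states and stabilizers\<close>

definition measurable_field_of_states ::
  "'x measure \<Rightarrow> ('x \<Rightarrow> 'a::unital_cstar_algebra \<Rightarrow> complex) \<Rightarrow> bool" where
  "measurable_field_of_states \<nu> \<Phi> \<longleftrightarrow>
     (\<forall>\<xi>\<in>space \<nu>. state (\<Phi> \<xi>)) \<and> (\<forall>a. (\<lambda>\<xi>. \<Phi> \<xi> a) \<in> borel_measurable \<nu>)"

definition decomposes ::
  "'x measure \<Rightarrow> (('x \<Rightarrow> 'a::unital_cstar_algebra) \<Rightarrow> complex) \<Rightarrow> ('x \<Rightarrow> 'a \<Rightarrow> complex) \<Rightarrow> bool" where
  "decomposes \<nu> \<phi> \<Phi> \<longleftrightarrow>
     (\<forall>A\<in>tensor_Linf \<nu>. \<phi> A = (\<integral>\<xi>. \<Phi> \<xi> (A \<xi>) \<partial>\<nu>))"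

definition equivariant_field ::
  "'x measure \<Rightarrow> ('h::group_add \<Rightarrow> 'a \<Rightarrow> 'a) \<Rightarrow> ('h \<Rightarrow> 'x \<Rightarrow> 'x)
    \<Rightarrow> ('x \<Rightarrow> 'a \<Rightarrow> complex) \<Rightarrow> bool" where
  "equivariant_field \<nu> \<alpha> T \<Phi> \<longleftrightarrow> (AE \<xi> in \<nu>. \<forall>x. \<Phi> \<xi> \<circ> \<alpha> x = \<Phi> (T (- x) \<xi>))"

definition tensor_stabilizer ::
  "'x measure \<Rightarrow> ('g \<Rightarrow> 'a::unital_cstar_algebra \<Rightarrow> 'a) \<Rightarrow> (('x \<Rightarrow> 'a) \<Rightarrow> complex) \<Rightarrow> 'g set" where
  "tensor_stabilizer \<nu> \<gamma> \<phi> = {g. \<forall>A\<in>tensor_Linf \<nu>. \<phi> (lift_gauge \<gamma> g A) = \<phi> A}"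

definition stabilizer :: "('g \<Rightarrow> 'a \<Rightarrow> 'a) \<Rightarrow> ('a \<Rightarrow> complex) \<Rightarrow> 'g set" where
  "stabilizer \<gamma> \<omega> = {g. \<omega> \<circ> \<gamma> g = \<omega>}"

end

theory Submission
  imports Defs
begin

text \<open>Write \<open>R \<xi>\<close> for the stabilizer of \<open>\<Phi> \<xi>\<close>. It is a closed subset of the compact group, and since
  \<open>\<alpha>\<close> commutes with \<open>\<gamma>\<close> and the field is equivariant, \<open>R\<close> is constant along almost every orbit of
  \<open>T\<close>. A closed-set-valued map that is invariant under an ergodic action is almost surely constant:
  for each open \<open>U\<close> of a countable base, the event that \<open>R \<xi>\<close> meets \<open>closure U\<close> is measurable
  and almost invariant, so it has probability zero or one, and these countably many events determine
  \<open>R \<xi>\<close> by regularity of the group (\<open>AE_constant_closed_set\<close>, \<open>AE_constant_stabilizer\<close>).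

  Let \<open>H\<close> be the almost sure value of \<open>R\<close>. A fixed \<open>g\<close> stabilizes \<open>\<phi>\<close> exactly when it stabilizes almost
  every \<open>\<Phi> \<xi>\<close>: one direction tests \<open>\<phi>\<close> on sections \<open>indicator S \<otimes> a\<close>, the other integrates
  (\<open>tensor_stabilizer_imp_AE_stabilizer\<close>, \<open>AE_stabilizer_imp_tensor_stabilizer\<close>). Because \<open>R\<close> is
  almost surely the constant \<open>H\<close>, stabilizing almost every \<open>\<Phi> \<xi>\<close> means belonging to \<open>H\<close>, so \<open>H\<close> is
  the stabilizer of \<open>\<phi>\<close>. The a priori uncountable union of exceptional sets, one for
  each \<open>g\<close>, is thereby avoided.

  Reducing conditions on all \<open>a\<close> to a dense sequence, and keeping sections measurable and
  approximable by the algebraic tensor product, both need the automorphisms \<open>\<gamma> g\<close> to be norm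
  continuous. This is automatic (\<open>star_automorphism_contractive\<close>); the proof below replaces the
  usual comparison of spectral radii by the fact that a self-adjoint strict contraction is the real
  part of a unitary.\<close>

section \<open>Automorphisms of a C*-algebra are contractive\<close>

lemma norm_gbinomial_half_le_1: "\<bar>(1/2::real) gchoose n\<bar> \<le> 1"
proof (induction n)
  case (Suc n)
  have "\<bar>(1/2::real) gchoose Suc n\<bar> = \<bar>(1/2) gchoose n\<bar> * (\<bar>1/2 - real n\<bar> / (real n + 1))"
  proof -
    have "((1/2::real) gchoose Suc n) = ((1/2) gchoose n) * ((1/2 - real n) / (real n + 1))"
      using gbinomial_mult_1[of "1/2::real" n] by (simp add: field_simps)
    then show ?thesis by (simp add: abs_mult)
  qed
  also have "\<dots> \<le> 1 * 1"
    by (intro mult_mono Suc.IH) (auto simp: divide_simps)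
  finally show ?case by simp
qed simp

lemma star_add_zero: "star (0::'a::unital_cstar_algebra) = 0"
  using star_add[of "0::'a" 0] by simp

lemma star_one: "star (1::'a::unital_cstar_algebra) = 1"
  using star_mult[of "star 1" "1::'a"] by (simp add: star_star)

lemma star_scaleR: "star (r *\<^sub>R a) = r *\<^sub>R star (a::'a::unital_cstar_algebra)"
  using star_scaleC[of "complex_of_real r" a] by (simp add: scaleC_of_real)

lemma norm_star: "norm (star a) = norm (a::'a::unital_cstar_algebra)"
proof -
  have le: "norm b \<le> norm (star b)" for b :: 'a
  proof (cases "b = 0")
    case False
    have "norm b * norm b \<le> norm (star b) * norm b"
      using norm_mult_ineq[of "star b" b] cstar_identity[of b] by (simp add: power2_eq_square)
    with False show ?thesis by simp
  qed simp
  from le[of a] le[of "star a"] show ?thesis by (simp add: star_star)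
qed

lemma bounded_linear_star: "bounded_linear (star :: 'a \<Rightarrow> 'a::unital_cstar_algebra)"
  by (intro bounded_linear_intro[of _ 1]) (auto simp: star_add star_scaleR norm_star)

lemma star_power: "star (a ^ n) = star (a::'a::unital_cstar_algebra) ^ n"
  by (induction n) (auto simp: star_one star_mult power_commutes)

text \<open>The binomial series for \<open>(1 - x)\<^sup>1\<^sup>/\<^sup>2\<close> converges for \<open>norm x < 1\<close>, its coefficients being bounded by one,
  and squares to \<open>1 - x\<close> by the Vandermonde identity. As a limit of real polynomials in \<open>x\<close> its sum
  inherits commutation with \<open>x\<close> and self-adjointness.\<close>

lemma exists_selfadjoint_sqrt_one_minus:
  fixes x :: "'a::unital_cstar_algebra"
  assumes "norm x < 1" "star x = x"
  shows "\<exists>s. s * s = 1 - x \<and> star s = s \<and> (\<forall>b. b * x = x * b \<longrightarrow> b * s = s * b)"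
proof -
  define c :: "nat \<Rightarrow> real" where "c n = (-1) ^ n * ((1/2) gchoose n)" for n
  define t where "t n = c n *\<^sub>R x ^ n" for n
  have c1: "\<bar>c n\<bar> \<le> 1" for n
    using norm_gbinomial_half_le_1[of n] by (simp add: c_def abs_mult)
  have sn: "summable (\<lambda>n. norm (t n))"
  proof (rule summable_comparison_test)
    show "summable (\<lambda>n. norm x ^ n)"
      using assms by (simp add: summable_geometric)
    have "norm (t n) \<le> norm x ^ n" for n
    proof -
      have "norm (t n) = \<bar>c n\<bar> * norm (x ^ n)" by (simp add: t_def)
      also have "\<dots> \<le> 1 * norm x ^ n"
        by (intro mult_mono c1 norm_power_ineq) auto
      finally show ?thesis by simp
    qed
    then show "\<exists>N. \<forall>n\<ge>N. norm (norm (t n)) \<le> norm x ^ n" by simp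
  qed
  then have su: "summable t" by (rule summable_norm_cancel)
  have conv: "(\<Sum>i\<le>k. t i * t (k - i)) = ((-1) ^ k * ((1::real) gchoose k)) *\<^sub>R x ^ k" for k
  proof -
    have "(\<Sum>i\<le>k. t i * t (k - i)) = (\<Sum>i\<le>k. (c i * c (k - i)) *\<^sub>R x ^ k)"
      by (intro sum.cong refl) (simp add: t_def power_add[symmetric])
    also have "\<dots> = (\<Sum>i\<le>k. c i * c (k - i)) *\<^sub>R x ^ k"
      by (simp add: scaleR_sum_left)
    also have "(\<Sum>i\<le>k. c i * c (k - i)) =
        (\<Sum>i\<le>k. (-1) ^ k * (((1/2) gchoose i) * ((1/2) gchoose (k - i))))"
    proof (intro sum.cong refl)
      fix i assume "i \<in> {..k}"
      then have sgn: "(-1::real) ^ i * (-1) ^ (k - i) = (-1) ^ k" by (simp add: power_add[symmetric])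
      have "c i * c (k - i) =
          ((-1) ^ i * (-1) ^ (k - i)) * (((1/2) gchoose i) * ((1/2) gchoose (k - i)))"
        unfolding c_def by (simp only: ac_simps)
      then show "c i * c (k - i) = (-1) ^ k * (((1/2) gchoose i) * ((1/2) gchoose (k - i)))"
        by (simp only: sgn)
    qed
    also have "\<dots> = (-1) ^ k * ((1::real) gchoose k)"
      using gbinomial_Vandermonde[of "1/2::real" "1/2" k]
      by (simp add: sum_distrib_left[symmetric] atLeast0AtMost)
    finally show ?thesis .
  qed
  have g: "((1::real) gchoose k) = (if k \<le> 1 then 1 else 0)" for k
    using binomial_gbinomial[of 1 k, where ?'a = real]
    by (auto simp: not_le binomial_eq_0 le_Suc_eq)
  define s where "s = (\<Sum>n. t n)"
  have "(\<lambda>k. ((-1) ^ k * ((1::real) gchoose k)) *\<^sub>R x ^ k) sums (s * s)"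
    using Cauchy_product_sums[OF sn sn] by (simp add: conv s_def)
  moreover have "(\<lambda>k. ((-1) ^ k * ((1::real) gchoose k)) *\<^sub>R x ^ k) sums (1 - x)"
  proof -
    have "(\<lambda>k. ((-1) ^ k * ((1::real) gchoose k)) *\<^sub>R x ^ k) sums
        (\<Sum>k\<in>{0,1}. ((-1) ^ k * ((1::real) gchoose k)) *\<^sub>R x ^ k)"
      by (rule sums_finite) (auto simp: g)
    then show ?thesis by (simp add: g)
  qed
  ultimately have "s * s = 1 - x" by (rule sums_unique2)
  moreover have "star s = s"
  proof -
    have "star (t n) = t n" for n by (simp add: t_def star_scaleR star_power assms)
    then show ?thesis
      using bounded_linear.suminf[OF bounded_linear_star su] by (simp add: s_def)
  qed
  moreover have "b * s = s * b" if "b * x = x * b" for b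
  proof -
    have "b * t n = t n * b" for n
      using that by (simp add: t_def power_commuting_commutes)
    then show ?thesis
      by (simp add: s_def suminf_mult[OF su, symmetric] suminf_mult2[OF su])
  qed
  ultimately show ?thesis by blast
qed

lemma norm_unitary:
  fixes u :: "'a::unital_cstar_algebra"
  assumes "star u * u = 1"
  shows "norm u = 1"
  using cstar_identity[of u] assms by (smt (verit) norm_ge_zero norm_one power2_eq_1_iff)

text \<open>The unitary is \<open>u = b + i e\<close> with \<open>e = (1 - b\<^sup>2)\<^sup>1\<^sup>/\<^sup>2\<close>. Since \<open>e\<close> is self-adjoint and commutes with
  \<open>b\<close>, the mixed terms of \<open>u\<^sup>*u\<close> cancel and \<open>b\<^sup>2 + e\<^sup>2 = 1\<close> remains.\<close>

lemma selfadjoint_real_part_of_unitary: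
  fixes b :: "'a::unital_cstar_algebra"
  assumes "norm b < 1" "star b = b"
  shows "\<exists>u. star u * u = 1 \<and> b = (1/2) *\<^sub>R (u + star u)"
proof -
  have "norm (b * b) < 1"
  proof -
    have "norm (b * b) \<le> norm b * norm b" by (rule norm_mult_ineq)
    also have "\<dots> < 1" using assms(1) by (smt (verit) mult_left_le norm_ge_zero)
    finally show ?thesis .
  qed
  then obtain e where e: "e * e = 1 - b * b" "star e = e" "b * e = e * b"
    using exists_selfadjoint_sqrt_one_minus[of "b * b"] assms(2)
    by (auto simp: star_mult mult.assoc)
  define u where "u = b + scaleC \<i> e"
  have su: "star u = b + scaleC (- \<i>) e"
    by (simp add: u_def star_add star_scaleC assms e)
  have neg: "scaleC (- \<i>) y = - scaleC \<i> y" for y :: 'a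
    using scaleC_add_left[of "\<i>" "-\<i>" y] scaleC_of_real[of 0 y]
    by (simp add: eq_neg_iff_add_eq_0 add.commute)
  have scaleC_diff: "scaleC c (y - z) = scaleC c y - scaleC c z" for c and y z :: 'a
    using scaleC_add_right[of c "y - z" z] by (simp add: algebra_simps)
  have ii: "scaleC (- 1) y = - y" for y :: 'a
    using scaleC_of_real[of "-1" y] by simp
  have "star u * u = 1"
    unfolding su neg unfolding u_def
    by (simp add: algebra_simps mult_scaleC_left mult_scaleC_right scaleC_diff scaleC_add_right scaleC_scaleC e ii)
  moreover have "b = (1/2) *\<^sub>R (u + star u)"
    unfolding su neg unfolding u_def by (simp add: scaleR_2[symmetric])
  ultimately show ?thesis by blast
qed

lemma star_automorphism_scaleR:
  assumes "star_automorphism \<theta>"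
  shows "\<theta> (r *\<^sub>R a) = r *\<^sub>R \<theta> a"
  using assms unfolding star_automorphism_def by (metis scaleC_of_real)

lemma star_automorphism_one:
  assumes "star_automorphism \<theta>"
  shows "\<theta> 1 = 1"
proof -
  obtain y where "\<theta> y = 1"
    using assms unfolding star_automorphism_def by (metis bij_pointE)
  then have "\<theta> (y * 1) = 1 * \<theta> 1"
    using assms unfolding star_automorphism_def by metis
  with \<open>\<theta> y = 1\<close> show ?thesis by simp
qed

text \<open>Unitaries go to unitaries, so the real part of a unitary goes to an element of norm at most
  one; scaling bounds \<open>\<theta>\<close> on self-adjoint elements, and the C*-identity carries the bound over
  from \<open>a\<^sup>*a\<close> to \<open>a\<close>.\<close>

lemma star_automorphism_contractive:
  fixes \<theta> :: "'a::unital_cstar_algebra \<Rightarrow> 'a"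
  assumes "star_automorphism \<theta>"
  shows "norm (\<theta> a) \<le> norm a"
proof -
  note A = assms[unfolded star_automorphism_def]
  have add: "\<theta> (x + y) = \<theta> x + \<theta> y" and mul: "\<theta> (x * y) = \<theta> x * \<theta> y"
    and st: "\<theta> (star x) = star (\<theta> x)" for x y
    using A by auto
  have unit_ball: "norm (\<theta> b) \<le> 1" if b: "norm b < 1" "star b = b" for b
  proof -
    obtain u where u: "star u * u = 1" "b = (1/2) *\<^sub>R (u + star u)"
      using selfadjoint_real_part_of_unitary[OF b] by blast
    have "star (\<theta> u) * \<theta> u = 1"
      using u(1) by (metis mul st star_automorphism_one[OF assms])
    then have n: "norm (\<theta> u) = 1" by (rule norm_unitary)
    have "\<theta> b = (1/2) *\<^sub>R (\<theta> u + star (\<theta> u))"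
      by (simp add: u(2) star_automorphism_scaleR[OF assms] add st)
    then have "norm (\<theta> b) = (1/2) * norm (\<theta> u + star (\<theta> u))" by simp
    also have "\<dots> \<le> (1/2) * (norm (\<theta> u) + norm (star (\<theta> u)))"
      by (intro mult_left_mono norm_triangle_ineq) simp
    finally show ?thesis by (simp add: norm_star n)
  qed
  have selfadjoint: "norm (\<theta> h) \<le> norm h" if "star h = h" for h
  proof (rule dense_ge)
    fix r assume "norm h < r"
    then have r: "r > 0" by (smt (verit) norm_ge_zero)
    have "norm (\<theta> ((1/r) *\<^sub>R h)) \<le> 1"
      by (rule unit_ball) (use r \<open>norm h < r\<close> that in \<open>auto simp: star_scaleR\<close>)
    then show "norm (\<theta> h) \<le> r"
      using r by (simp add: star_automorphism_scaleR[OF assms] divide_simps)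
  qed
  have "(norm (\<theta> a))\<^sup>2 = norm (\<theta> (star a * a))"
    by (simp add: mul st cstar_identity)
  also have "\<dots> \<le> norm (star a * a)"
    by (rule selfadjoint) (simp add: star_mult star_star)
  finally have "(norm (\<theta> a))\<^sup>2 \<le> (norm a)\<^sup>2" by (simp add: cstar_identity)
  then show ?thesis by (rule power2_le_imp_le) simp
qed

lemma star_automorphism_continuous:
  fixes \<theta> :: "'a::unital_cstar_algebra \<Rightarrow> 'a"
  assumes "star_automorphism \<theta>"
  shows "continuous_on UNIV \<theta>"
proof -
  have "bounded_linear \<theta>"
    using assms star_automorphism_scaleR[OF assms] star_automorphism_contractive[OF assms]
    by (intro bounded_linear_intro[of _ 1]) (auto simp: star_automorphism_def)
  then show ?thesis by (rule linear_continuous_on)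
qed

lemma state_scaleR:
  assumes "state \<omega>"
  shows "\<omega> (r *\<^sub>R a) = r *\<^sub>R \<omega> a"
  using assms unfolding state_def by (metis scaleC_of_real scaleR_conv_of_real)

lemma state_continuous:
  fixes \<omega> :: "'a::unital_cstar_algebra \<Rightarrow> complex"
  assumes "state \<omega>"
  shows "continuous_on UNIV \<omega>"
proof -
  have "bounded_linear \<omega>"
    using assms state_scaleR[OF assms] by (intro bounded_linear_intro[of _ 1]) (auto simp: state_def)
  then show ?thesis by (rule linear_continuous_on)
qed

section \<open>Ergodicity and random closed sets\<close>

text \<open>The points whose whole orbit lies in \<open>E\<close> form a strictly invariant set, which differs from an
  almost invariant \<open>E\<close> by a null set.\<close>

lemma ergodic_action_zero_one:
  fixes T :: "'h::{group_add, countable} \<Rightarrow> 'x \<Rightarrow> 'x"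
  assumes "prob_space \<nu>" "ergodic_action \<nu> T" and E: "E \<in> sets \<nu>"
    and inv: "AE \<xi> in \<nu>. \<xi> \<in> E \<longrightarrow> (\<forall>x. T x \<xi> \<in> E)"
  shows "(AE \<xi> in \<nu>. \<xi> \<in> E) \<or> (AE \<xi> in \<nu>. \<xi> \<notin> E)"
proof -
  interpret prob_space \<nu> by fact
  have T: "T x \<in> measurable \<nu> \<nu>" and Ta: "T (x + y) \<xi> = T x (T y \<xi>)" and T0: "T 0 \<xi> = \<xi>" for x y \<xi>
    using assms(2) unfolding ergodic_action_def measure_preserving_action_def action_def by auto
  define E' where "E' = {\<xi>\<in>space \<nu>. \<forall>x. T x \<xi> \<in> E}"
  have meas: "E' \<in> sets \<nu>"
  proof -
    have "E' = (\<Inter>x. T x -` E \<inter> space \<nu>)" by (auto simp: E'_def)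
    also have "\<dots> \<in> sets \<nu>"
      by (intro sets.countable_INT' image_subsetI) (auto intro: measurable_sets[OF T E])
    finally show ?thesis .
  qed
  have "T y -` E' \<inter> space \<nu> = E'" for y
  proof (intro set_eqI iffI)
    fix \<xi> assume "\<xi> \<in> T y -` E' \<inter> space \<nu>"
    then have *: "\<xi> \<in> space \<nu>" "T x (T y \<xi>) \<in> E" for x by (auto simp: E'_def)
    from *(2)[of "x - y" for x] have "T x \<xi> \<in> E" for x by (simp add: Ta[symmetric])
    with *(1) show "\<xi> \<in> E'" by (simp add: E'_def)
  next
    fix \<xi> assume "\<xi> \<in> E'"
    then show "\<xi> \<in> T y -` E' \<inter> space \<nu>"
      using measurable_space[OF T] by (auto simp: E'_def Ta[symmetric])
  qed
  then have "prob E' = 0 \<or> prob E' = 1"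
    using assms(2) meas unfolding ergodic_action_def by blast
  moreover have "E' \<subseteq> E" unfolding E'_def by clarsimp (metis T0)
  moreover have ae: "AE \<xi> in \<nu>. \<xi> \<in> E \<longrightarrow> \<xi> \<in> E'"
    using inv AE_space by eventually_elim (auto simp: E'_def)
  ultimately show ?thesis
  proof (elim disjE)
    assume "prob E' = 0"
    then have "AE \<xi> in \<nu>. \<xi> \<notin> E'"
      using meas by (simp add: AE_iff_measurable[OF meas] emeasure_eq_measure prob_eq_0)
    with ae have "AE \<xi> in \<nu>. \<xi> \<notin> E" by eventually_elim blast
    then show ?thesis ..
  next
    assume "prob E' = 1" "E' \<subseteq> E"
    then have "AE \<xi> in \<nu>. \<xi> \<in> E'" using meas by (simp add: prob_eq_1)
    then have "AE \<xi> in \<nu>. \<xi> \<in> E" by eventually_elim (use \<open>E' \<subseteq> E\<close> in blast)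
    then show ?thesis ..
  qed
qed

lemma compact_t2_regular:
  fixes g :: "'g::t2_space"
  assumes "compact (UNIV :: 'g set)" "closed C" "g \<notin> C"
  shows "\<exists>U. open U \<and> g \<in> U \<and> closure U \<inter> C = {}"
proof -
  have "Hausdorff_space (euclidean :: 'g topology)"
    unfolding Hausdorff_space_def disjnt_def by (simp, metis hausdorff)
  moreover have "compact_space (euclidean :: 'g topology)"
    using assms(1) by (simp add: compact_space_def)
  ultimately have "regular_space (euclidean :: 'g topology)"
    by (simp add: compact_Hausdorff_imp_regular_space)
  then show ?thesis
    using assms(2,3) unfolding regular_space by (fastforce simp: disjnt_def)
qed

text \<open>In a regular second countable space a closed set is determined by the members of a countable
  base whose closures it meets, so countably many zero-one events determine it almost surely.\<close>

lemma AE_constant_closed_set: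
  fixes R :: "'x \<Rightarrow> 'g::{t2_space, second_countable_topology} set"
  assumes "prob_space \<nu>" "compact (UNIV :: 'g set)"
    and closed: "\<And>\<xi>. \<xi> \<in> space \<nu> \<Longrightarrow> closed (R \<xi>)"
    and zero_one: "\<And>U. open U \<Longrightarrow>
      (AE \<xi> in \<nu>. R \<xi> \<inter> closure U \<noteq> {}) \<or> (AE \<xi> in \<nu>. R \<xi> \<inter> closure U = {})"
  shows "\<exists>H. AE \<xi> in \<nu>. R \<xi> = H"
proof -
  interpret prob_space \<nu> by fact
  obtain B :: "'g set set" where B: "countable B" "topological_basis B"
    using ex_countable_basis by blast
  define hit where "hit U \<longleftrightarrow> (AE \<xi> in \<nu>. R \<xi> \<inter> closure U \<noteq> {})" for U
  have "AE \<xi> in \<nu>. R \<xi> \<inter> closure U \<noteq> {} \<longleftrightarrow> hit U" if "U \<in> B" for U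
  proof (cases "hit U")
    case True
    from this[unfolded hit_def] show ?thesis by eventually_elim (use True in simp)
  next
    case False
    then have "AE \<xi> in \<nu>. R \<xi> \<inter> closure U = {}"
      using zero_one[OF topological_basis_open[OF B(2) that]] by (simp only: hit_def simp_thms)
    then show ?thesis by eventually_elim (use False in simp)
  qed
  then have hits: "AE \<xi> in \<nu>. \<forall>U\<in>B. R \<xi> \<inter> closure U \<noteq> {} \<longleftrightarrow> hit U"
    using B(1) by (simp add: AE_ball_countable)
  have determined: "R \<xi> = {g. \<forall>U\<in>B. g \<in> U \<longrightarrow> hit U}"
    if \<xi>: "\<xi> \<in> space \<nu>" and h: "\<forall>U\<in>B. R \<xi> \<inter> closure U \<noteq> {} \<longleftrightarrow> hit U" for \<xi>
  proof (intro set_eqI iffI)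
    fix g assume "g \<in> R \<xi>"
    with h closure_subset show "g \<in> {g. \<forall>U\<in>B. g \<in> U \<longrightarrow> hit U}" by blast
  next
    fix g assume g: "g \<in> {g. \<forall>U\<in>B. g \<in> U \<longrightarrow> hit U}"
    show "g \<in> R \<xi>"
    proof (rule ccontr)
      assume "g \<notin> R \<xi>"
      then obtain U where U: "open U" "g \<in> U" "closure U \<inter> R \<xi> = {}"
        using compact_t2_regular[OF assms(2) closed[OF \<xi>]] by blast
      obtain V where V: "V \<in> B" "g \<in> V" "V \<subseteq> U"
        using topological_basisE[OF B(2) U(1,2)] .
      have "hit V" using g V by simp
      with bspec[OF h V(1)] have "R \<xi> \<inter> closure V \<noteq> {}" by (simp only: simp_thms)
      with closure_mono[OF V(3)] U(3) show False by blast
    qed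
  qed
  from AE_space hits have "AE \<xi> in \<nu>. R \<xi> = {g. \<forall>U\<in>B. g \<in> U \<longrightarrow> hit U}"
    by eventually_elim (rule determined)
  then show ?thesis by blast
qed

text \<open>Compactness turns the existence of a common zero in \<open>closure U\<close> into the existence of
  approximate common zeros, and these may be sought in a countable dense subset of \<open>U\<close>. The right
  side involves only countable quantifiers, which is what makes the condition measurable when
  \<open>f\<close> depends on a parameter.\<close>

lemma common_zero_in_closure_iff:
  fixes f :: "nat \<Rightarrow> 'g::topological_space \<Rightarrow> real"
  assumes cpt: "compact (UNIV :: 'g set)" and cont: "\<And>n. continuous_on UNIV (f n)"
    and nonneg: "\<And>n g. 0 \<le> f n g"
    and dense: "\<And>V. open V \<Longrightarrow> V \<noteq> {} \<Longrightarrow> \<exists>d\<in>D. d \<in> V" and U: "open U"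
  shows "{g. \<forall>n. f n g = 0} \<inter> closure U \<noteq> {} \<longleftrightarrow>
    (\<forall>N. \<exists>g\<in>D \<inter> U. \<forall>n\<le>N. f n g < 1 / Suc N)"
proof
  assume "{g. \<forall>n. f n g = 0} \<inter> closure U \<noteq> {}"
  then obtain g where g: "f n g = 0" "g \<in> closure U" for n by auto
  show "\<forall>N. \<exists>g\<in>D \<inter> U. \<forall>n\<le>N. f n g < 1 / Suc N"
  proof
    fix N
    define V where "V = (\<Inter>n\<in>{..N}. {g. f n g < 1 / Suc N})"
    have V: "open V" unfolding V_def by (intro open_INT ballI open_Collect_less cont) auto
    have "g \<in> V" by (simp add: V_def g)
    with V g(2) have "V \<inter> U \<noteq> {}"
      using open_Int_closure_eq_empty[of V U] by auto
    then obtain d where "d \<in> D" "d \<in> V \<inter> U" using dense V U by (meson open_Int)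
    then show "\<exists>g\<in>D \<inter> U. \<forall>n\<le>N. f n g < 1 / Suc N" by (auto simp: V_def)
  qed
next
  assume app: "\<forall>N. \<exists>g\<in>D \<inter> U. \<forall>n\<le>N. f n g < 1 / Suc N"
  \<comment> \<open>The sets \<open>C N\<close> decrease to the common zeros in \<open>closure U\<close>; the approximate zeros make each
    of them nonempty, and compactness makes the intersection nonempty.\<close>
  define C where "C N = closure U \<inter> (\<Inter>n\<in>{..N}. {g. f n g \<le> 1 / Suc N})" for N
  have closed: "closed (C N)" for N
    unfolding C_def by (intro closed_Int closed_INT ballI closed_Collect_le cont) auto
  have fip: "UNIV \<inter> (\<Inter>N\<in>I. C N) \<noteq> {}" if "finite I" for I
  proof -
    obtain g where g: "g \<in> U" "\<forall>n\<le>Max I. f n g < 1 / Suc (Max I)" using app by blast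
    have "g \<in> C N" if "N \<in> I" for N
    proof -
      have "N \<le> Max I" using that \<open>finite I\<close> by simp
      then have "1 / real (Suc (Max I)) \<le> 1 / Suc N" by (simp add: frac_le)
      moreover have "f n g < 1 / Suc (Max I)" if "n \<le> N" for n
        using g(2) that \<open>N \<le> Max I\<close> by simp
      ultimately show ?thesis
        using g(1) closure_subset[of U] by (fastforce simp: C_def)
    qed
    then show ?thesis by auto
  qed
  have "UNIV \<inter> (\<Inter>N\<in>UNIV. C N) \<noteq> {}"
    by (rule compact_imp_fip_image[OF cpt closed fip])
  then obtain g where g: "g \<in> C N" for N by auto
  have "f n g = 0" for n
  proof (rule antisym[OF _ nonneg], rule field_le_epsilon)
    fix e :: real assume "e > 0"
    then obtain M where M: "1 / Suc M < e"
      using nat_approx_posE by blast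
    have "f n g \<le> 1 / Suc (max n M)" using g[of "max n M"] by (auto simp: C_def)
    also have "\<dots> \<le> 1 / Suc M" by (simp add: frac_le)
    finally show "f n g \<le> 0 + e" using M by simp
  qed
  moreover have "g \<in> closure U" using g[of 0] by (simp add: C_def)
  ultimately show "{g. \<forall>n. f n g = 0} \<inter> closure U \<noteq> {}" by auto
qed

section \<open>Stabilizers in a measurable field of states\<close>

lemma exists_dense_sequence:
  "\<exists>a :: nat \<Rightarrow> 'a::second_countable_topology. \<forall>V. open V \<longrightarrow> V \<noteq> {} \<longrightarrow> (\<exists>d\<in>range a. d \<in> V)"
proof -
  obtain A :: "'a set" where A: "countable A" "\<And>V. open V \<Longrightarrow> V \<noteq> {} \<Longrightarrow> \<exists>d\<in>A. d \<in> V"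
    by (rule countable_dense_setE) blast
  have "A \<noteq> {}" using A(2)[of UNIV] by auto
  then have "range (from_nat_into A) = A" using A(1) by (simp add: range_from_nat_into)
  with A(2) show ?thesis by (intro exI[of _ "from_nat_into A"]) auto
qed

lemma continuous_eq_on_dense:
  fixes f h :: "'a::topological_space \<Rightarrow> 'b::t2_space"
  assumes "continuous_on UNIV f" "continuous_on UNIV h"
    and "\<And>V. open V \<Longrightarrow> V \<noteq> {} \<Longrightarrow> \<exists>d\<in>D. d \<in> V" and eq: "\<And>d. d \<in> D \<Longrightarrow> f d = h d"
  shows "f = h"
proof (rule ccontr)
  assume "f \<noteq> h"
  then have "{x. f x \<noteq> h x} \<noteq> {}" by auto
  moreover have "open {x. f x \<noteq> h x}" by (rule open_Collect_neq) fact+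
  ultimately show False using assms(3) eq by blast
qed

text \<open>Both \<open>\<omega> \<circ> \<gamma> g\<close> and \<open>\<omega>\<close> are norm continuous, so they are equal once they agree on a dense
  sequence.\<close>

lemma stabilizer_eq_common_zeros:
  fixes \<gamma> :: "'g \<Rightarrow> 'a::unital_cstar_algebra \<Rightarrow> 'a"
  assumes "state \<omega>" and aut: "\<And>g. star_automorphism (\<gamma> g)"
    and "\<And>V. open V \<Longrightarrow> V \<noteq> {} \<Longrightarrow> \<exists>d\<in>range a. d \<in> V"
  shows "stabilizer \<gamma> \<omega> = {g. \<forall>n::nat. cmod (\<omega> (\<gamma> g (a n)) - \<omega> (a n)) = 0}"
proof -
  have "\<omega> \<circ> \<gamma> g = \<omega>" if "\<forall>n. \<omega> (\<gamma> g (a n)) = \<omega> (a n)" for g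
  proof (rule continuous_eq_on_dense[OF _ state_continuous[OF assms(1)] assms(3)])
    show "continuous_on UNIV (\<omega> \<circ> \<gamma> g)"
      by (rule continuous_on_compose[OF star_automorphism_continuous[OF aut]
          continuous_on_subset[OF state_continuous[OF assms(1)]]]) simp
  qed (use that in auto)
  then show ?thesis by (auto simp: stabilizer_def fun_eq_iff)
qed

lemma closed_stabilizer:
  fixes \<gamma> :: "'g::topological_space \<Rightarrow> 'a::unital_cstar_algebra \<Rightarrow> 'a"
  assumes "state \<omega>" and cont: "\<And>a. continuous_on UNIV (\<lambda>g. \<gamma> g a)"
  shows "closed (stabilizer \<gamma> \<omega>)"
proof -
  have "stabilizer \<gamma> \<omega> = (\<Inter>a. {g. \<omega> (\<gamma> g a) = \<omega> a})"
    by (auto simp: stabilizer_def fun_eq_iff)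
  also have "closed \<dots>"
    by (intro closed_INT ballI closed_Collect_eq continuous_on_compose2[OF
        state_continuous[OF assms(1)] cont]) auto
  finally show ?thesis .
qed

lemma stabilizer_comp:
  assumes "surj \<theta>" "\<And>g. \<theta> \<circ> \<gamma> g = \<gamma> g \<circ> \<theta>"
  shows "stabilizer \<gamma> (\<omega> \<circ> \<theta>) = stabilizer \<gamma> \<omega>"
proof -
  have "\<omega> \<circ> \<theta> \<circ> \<gamma> g = \<omega> \<circ> \<theta> \<longleftrightarrow> \<omega> \<circ> \<gamma> g = \<omega>" for g
  proof -
    have "\<omega> \<circ> \<theta> \<circ> \<gamma> g = \<omega> \<circ> \<gamma> g \<circ> \<theta>" using assms(2)[of g] by (simp add: comp_assoc)
    moreover have "\<omega> \<circ> \<gamma> g = \<omega>" if "\<omega> \<circ> \<gamma> g \<circ> \<theta> = \<omega> \<circ> \<theta>"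
    proof
      fix a
      obtain b where "a = \<theta> b" using assms(1) by (rule surjE)
      with fun_cong[OF that, of b] show "(\<omega> \<circ> \<gamma> g) a = \<omega> a" by simp
    qed
    ultimately show ?thesis by metis
  qed
  then show ?thesis by (simp add: stabilizer_def)
qed

text \<open>The stabilizer of \<open>\<Phi> \<xi>\<close> is a closed subset of a compact group, and it is constant along almost
  every orbit since \<open>\<alpha>\<close> commutes with \<open>\<gamma>\<close>. Whether it meets the closure of a given open set is
  therefore an almost invariant event.\<close>

lemma AE_constant_stabilizer:
  fixes \<gamma> :: "'g::{t2_space, second_countable_topology}
      \<Rightarrow> 'a::{unital_cstar_algebra, second_countable_topology} \<Rightarrow> 'a"
    and T :: "'h::{group_add, countable} \<Rightarrow> 'x \<Rightarrow> 'x"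
  assumes "compact (UNIV :: 'g set)"
    and aut: "\<And>g. star_automorphism (\<gamma> g)"
    and cont: "\<And>a. continuous_on UNIV (\<lambda>g. \<gamma> g a)"
    and surj: "\<And>x. surj (\<alpha> x)"
    and comm: "\<And>x g. \<alpha> x \<circ> \<gamma> g = \<gamma> g \<circ> \<alpha> x"
    and "prob_space \<nu>" "ergodic_action \<nu> T"
    and field: "measurable_field_of_states \<nu> \<Phi>"
    and equi: "equivariant_field \<nu> \<alpha> T \<Phi>"
  shows "\<exists>H. AE \<xi> in \<nu>. stabilizer \<gamma> (\<Phi> \<xi>) = H"
proof (rule AE_constant_closed_set)
  show "prob_space \<nu>" "compact (UNIV :: 'g set)" by fact+
next
  fix \<xi> assume "\<xi> \<in> space \<nu>"
  then show "closed (stabilizer \<gamma> (\<Phi> \<xi>))"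
    using field cont by (intro closed_stabilizer) (auto simp: measurable_field_of_states_def)
next
  fix U :: "'g set" assume "open U"
  have [measurable]: "(\<lambda>\<xi>. \<Phi> \<xi> a) \<in> borel_measurable \<nu>" for a
    using field by (simp add: measurable_field_of_states_def)
  obtain D :: "'g set" where D: "countable D" "\<And>V. open V \<Longrightarrow> V \<noteq> {} \<Longrightarrow> \<exists>d\<in>D. d \<in> V"
    by (rule countable_dense_setE) blast
  obtain a :: "nat \<Rightarrow> 'a" where a: "\<And>V. open V \<Longrightarrow> V \<noteq> {} \<Longrightarrow> \<exists>d\<in>range a. d \<in> V"
    using exists_dense_sequence by blast
  have meets_iff: "stabilizer \<gamma> (\<Phi> \<xi>) \<inter> closure U \<noteq> {} \<longleftrightarrow>
      (\<forall>N. \<exists>g\<in>D \<inter> U. \<forall>n\<le>N. cmod (\<Phi> \<xi> (\<gamma> g (a n)) - \<Phi> \<xi> (a n)) < 1 / Suc N)"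
    if "\<xi> \<in> space \<nu>" for \<xi>
  proof -
    have st: "state (\<Phi> \<xi>)" using field that by (simp add: measurable_field_of_states_def)
    have "stabilizer \<gamma> (\<Phi> \<xi>) = {g. \<forall>n::nat. cmod (\<Phi> \<xi> (\<gamma> g (a n)) - \<Phi> \<xi> (a n)) = 0}"
      by (rule stabilizer_eq_common_zeros[OF st aut a])
    then show ?thesis
      by (simp only:) (intro common_zero_in_closure_iff assms(1) D(2) \<open>open U\<close> continuous_intros
          continuous_on_compose2[OF state_continuous[OF st] cont]; simp)
  qed
  define E where "E = {\<xi>\<in>space \<nu>. stabilizer \<gamma> (\<Phi> \<xi>) \<inter> closure U \<noteq> {}}"
  have "E = {\<xi>\<in>space \<nu>. \<forall>N. \<exists>g\<in>D \<inter> U. \<forall>n\<in>{..N}.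
      cmod (\<Phi> \<xi> (\<gamma> g (a n)) - \<Phi> \<xi> (a n)) < 1 / Suc N}"
    unfolding E_def by (simp only: meets_iff Ball_def atMost_iff cong: conj_cong)
  also have "\<dots> \<in> sets \<nu>"
  proof -
    have "countable (D \<inter> U)" using D(1) by simp
    then show ?thesis
      by (intro sets.sets_Collect_countable_All sets.sets_Collect_countable_Ex'
          sets.sets_Collect_finite_All') measurable
  qed
  finally have E: "E \<in> sets \<nu>" .
  have T: "T x \<in> measurable \<nu> \<nu>" for x
    using \<open>ergodic_action \<nu> T\<close> by (simp add: ergodic_action_def measure_preserving_action_def)
  have "AE \<xi> in \<nu>. \<xi> \<in> E \<longrightarrow> (\<forall>x. T x \<xi> \<in> E)"
    using equi[unfolded equivariant_field_def]
  proof eventually_elim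
    case (elim \<xi>)
    have "stabilizer \<gamma> (\<Phi> (T x \<xi>)) = stabilizer \<gamma> (\<Phi> \<xi>)" for x
      using elim[rule_format, of "- x"] stabilizer_comp[OF surj[of "- x"] comm, where \<omega> = "\<Phi> \<xi>"] by simp
    with measurable_space[OF T] show ?case by (simp add: E_def)
  qed
  from ergodic_action_zero_one[OF \<open>prob_space \<nu>\<close> \<open>ergodic_action \<nu> T\<close> E this]
  show "(AE \<xi> in \<nu>. stabilizer \<gamma> (\<Phi> \<xi>) \<inter> closure U \<noteq> {}) \<or>
      (AE \<xi> in \<nu>. stabilizer \<gamma> (\<Phi> \<xi>) \<inter> closure U = {})"
  proof (rule disj_forward)
    show "AE \<xi> in \<nu>. stabilizer \<gamma> (\<Phi> \<xi>) \<inter> closure U \<noteq> {}" if "AE \<xi> in \<nu>. \<xi> \<in> E"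
      using that by eventually_elim (simp add: E_def)
    show "AE \<xi> in \<nu>. stabilizer \<gamma> (\<Phi> \<xi>) \<inter> closure U = {}" if "AE \<xi> in \<nu>. \<xi> \<notin> E"
      using that AE_space by eventually_elim (simp add: E_def)
  qed
qed

section \<open>The stabilizer of the integrated state\<close>

lemma tensor_Linf_indicator:
  fixes a :: "'a::{unital_cstar_algebra, second_countable_topology}"
  assumes S: "S \<in> sets \<nu>"
  shows "(\<lambda>\<xi>. indicat_real S \<xi> *\<^sub>R a) \<in> tensor_Linf \<nu>"
proof -
  have "(\<lambda>\<xi>. complex_of_real (indicat_real S \<xi>)) \<in> Linf \<nu>"
    using S unfolding Linf_def by (auto intro!: exI[of _ 1] simp: indicator_def)
  then have "(\<lambda>\<xi>. indicat_real S \<xi> *\<^sub>R a) \<in> alg_tensor_Linf \<nu>"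
    unfolding alg_tensor_Linf_def
    by (auto intro!: exI[of _ "1::nat"] exI[of _ "\<lambda>_. a"]
        exI[of _ "\<lambda>_ \<xi>. complex_of_real (indicat_real S \<xi>)"] simp: scaleC_of_real)
  moreover have "(\<lambda>\<xi>. indicat_real S \<xi> *\<^sub>R a) \<in> Linf \<nu>"
    using S unfolding Linf_def by (auto intro!: exI[of _ "norm a"] simp: indicator_def)
  ultimately show ?thesis
    unfolding tensor_Linf_def by (auto intro!: bexI)
qed

lemma tensor_Linf_AE_cong:
  assumes "A \<in> tensor_Linf \<nu>" "A' \<in> borel_measurable \<nu>" and eq: "AE \<xi> in \<nu>. A' \<xi> = A \<xi>"
  shows "A' \<in> tensor_Linf \<nu>"
proof -
  obtain C where C: "AE \<xi> in \<nu>. norm (A \<xi>) \<le> C"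
    using assms(1) by (auto simp: tensor_Linf_def Linf_def)
  have "AE \<xi> in \<nu>. norm (A' \<xi>) \<le> C" using C eq by eventually_elim simp
  moreover have "AE \<xi> in \<nu>. norm (A' \<xi> - B \<xi>) \<le> e" if "AE \<xi> in \<nu>. norm (A \<xi> - B \<xi>) \<le> e" for B e
    using that eq by eventually_elim simp
  ultimately show ?thesis
    using assms(1,2) unfolding tensor_Linf_def Linf_def by blast
qed

lemma star_automorphism_sum:
  assumes "star_automorphism \<theta>"
  shows "\<theta> (\<Sum>i<n. scaleC (f i) (a i)) = (\<Sum>i<(n::nat). scaleC (f i) (\<theta> (a i)))"
  using assms star_automorphism_scaleR[OF assms, of 0]
  by (induction n) (auto simp: star_automorphism_def)

text \<open>Being contractive, \<open>\<gamma> g\<close> preserves measurability and essential bounds, and it carries an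
  approximation by elementary tensors to one of the same quality.\<close>

lemma tensor_Linf_lift_gauge:
  fixes \<gamma> :: "'g \<Rightarrow> 'a::{unital_cstar_algebra, second_countable_topology} \<Rightarrow> 'a"
  assumes aut: "star_automorphism (\<gamma> g)" and A: "A \<in> tensor_Linf \<nu>"
  shows "lift_gauge \<gamma> g A \<in> tensor_Linf \<nu>"
proof -
  note contr = star_automorphism_contractive[OF aut]
  have diff: "\<gamma> g (x - y) = \<gamma> g x - \<gamma> g y" for x y
  proof -
    have "\<gamma> g ((x - y) + y) = \<gamma> g (x - y) + \<gamma> g y"
      using aut unfolding star_automorphism_def by blast
    then show ?thesis by (simp add: algebra_simps)
  qed
  have "A \<in> borel_measurable \<nu>" using A by (simp add: tensor_Linf_def Linf_def)
  then have "lift_gauge \<gamma> g A \<in> borel_measurable \<nu>"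
    unfolding lift_gauge_def
    by (rule borel_measurable_continuous_on[OF star_automorphism_continuous[OF aut]])
  moreover obtain C where C: "AE \<xi> in \<nu>. norm (A \<xi>) \<le> C"
    using A by (auto simp: tensor_Linf_def Linf_def)
  have "AE \<xi> in \<nu>. norm (lift_gauge \<gamma> g A \<xi>) \<le> C"
    using C unfolding lift_gauge_def by eventually_elim (rule order_trans[OF contr])
  moreover have "\<exists>B\<in>alg_tensor_Linf \<nu>. AE \<xi> in \<nu>. norm (lift_gauge \<gamma> g A \<xi> - B \<xi>) \<le> e"
    if e: "e > 0" for e
  proof -
    obtain B where B: "B \<in> alg_tensor_Linf \<nu>" "AE \<xi> in \<nu>. norm (A \<xi> - B \<xi>) \<le> e"
      using A e unfolding tensor_Linf_def by blast
    then obtain n :: nat and a f where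
      naf: "\<forall>i<n. f i \<in> Linf \<nu>" "B = (\<lambda>\<xi>. \<Sum>i<n. scaleC (f i \<xi>) (a i))"
      unfolding alg_tensor_Linf_def by blast
    have "lift_gauge \<gamma> g B = (\<lambda>\<xi>. \<Sum>i<n. scaleC (f i \<xi>) (\<gamma> g (a i)))"
      by (simp add: lift_gauge_def naf(2) star_automorphism_sum[OF aut])
    then have "lift_gauge \<gamma> g B \<in> alg_tensor_Linf \<nu>"
      unfolding alg_tensor_Linf_def mem_Collect_eq
      by (intro exI[of _ n] exI[of _ "\<lambda>i. \<gamma> g (a i)"] exI[of _ f] conjI naf(1))
    moreover have "AE \<xi> in \<nu>. norm (lift_gauge \<gamma> g A \<xi> - lift_gauge \<gamma> g B \<xi>) \<le> e"
      using B(2) unfolding lift_gauge_def diff[symmetric]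
      by eventually_elim (rule order_trans[OF contr])
    ultimately show ?thesis by blast
  qed
  ultimately show ?thesis unfolding tensor_Linf_def Linf_def by blast
qed

text \<open>Testing the invariance of \<open>\<phi>\<close> on the sections \<open>indicator S \<otimes> a\<close> shows that \<open>\<Phi> \<xi> (\<gamma> g a)\<close> and
  \<open>\<Phi> \<xi> a\<close> have the same integral over every measurable set, hence agree for almost every \<open>\<xi>\<close>,
  simultaneously for all \<open>a\<close> in a dense sequence. Continuity extends this to every \<open>a\<close>.\<close>

lemma tensor_stabilizer_imp_AE_stabilizer:
  fixes \<gamma> :: "'g \<Rightarrow> 'a::{unital_cstar_algebra, second_countable_topology} \<Rightarrow> 'a"
  assumes "prob_space \<nu>" and aut: "\<And>g. star_automorphism (\<gamma> g)"
    and field: "measurable_field_of_states \<nu> \<Phi>" and dec: "decomposes \<nu> \<phi> \<Phi>"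
    and g: "g \<in> tensor_stabilizer \<nu> \<gamma> \<phi>"
  shows "AE \<xi> in \<nu>. g \<in> stabilizer \<gamma> (\<Phi> \<xi>)"
proof -
  interpret prob_space \<nu> by fact
  have st: "state (\<Phi> \<xi>)" if "\<xi> \<in> space \<nu>" for \<xi>
    using field that by (simp add: measurable_field_of_states_def)
  have integrable: "integrable \<nu> (\<lambda>\<xi>. \<Phi> \<xi> a)" for a
    using field st by (intro integrable_const_bound[where B = "norm a"])
      (auto simp: measurable_field_of_states_def state_def)
  have integral: "\<phi> (\<lambda>\<xi>. indicat_real S \<xi> *\<^sub>R a) = set_lebesgue_integral \<nu> S (\<lambda>\<xi>. \<Phi> \<xi> a)"
    if "S \<in> sets \<nu>" for S a
  proof -
    have "\<phi> (\<lambda>\<xi>. indicat_real S \<xi> *\<^sub>R a) = (\<integral>\<xi>. \<Phi> \<xi> (indicat_real S \<xi> *\<^sub>R a) \<partial>\<nu>)"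
      using dec tensor_Linf_indicator[OF that] unfolding decomposes_def by blast
    also have "\<dots> = set_lebesgue_integral \<nu> S (\<lambda>\<xi>. \<Phi> \<xi> a)"
      unfolding set_lebesgue_integral_def
      by (intro Bochner_Integration.integral_cong refl state_scaleR st)
    finally show ?thesis .
  qed
  have AE_eq: "AE \<xi> in \<nu>. \<Phi> \<xi> (\<gamma> g a) = \<Phi> \<xi> a" for a
  proof (rule density_unique_banach[OF integrable integrable])
    fix S assume S: "S \<in> sets \<nu>"
    have "lift_gauge \<gamma> g (\<lambda>\<xi>. indicat_real S \<xi> *\<^sub>R a) = (\<lambda>\<xi>. indicat_real S \<xi> *\<^sub>R \<gamma> g a)"
      by (simp add: lift_gauge_def star_automorphism_scaleR[OF aut])
    moreover have "\<phi> (lift_gauge \<gamma> g (\<lambda>\<xi>. indicat_real S \<xi> *\<^sub>R a)) = \<phi> (\<lambda>\<xi>. indicat_real S \<xi> *\<^sub>R a)"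
      using g tensor_Linf_indicator[OF S, of a] unfolding tensor_stabilizer_def by blast
    ultimately show "set_lebesgue_integral \<nu> S (\<lambda>\<xi>. \<Phi> \<xi> (\<gamma> g a)) = set_lebesgue_integral \<nu> S (\<lambda>\<xi>. \<Phi> \<xi> a)"
      unfolding integral[OF S, symmetric] by (simp only:)
  qed
  obtain a :: "nat \<Rightarrow> 'a" where a: "\<And>V. open V \<Longrightarrow> V \<noteq> {} \<Longrightarrow> \<exists>d\<in>range a. d \<in> V"
    using exists_dense_sequence by blast
  have "AE \<xi> in \<nu>. \<forall>n. \<Phi> \<xi> (\<gamma> g (a n)) = \<Phi> \<xi> (a n)"
    unfolding AE_all_countable using AE_eq by blast
  with AE_space show ?thesis
  proof eventually_elim
    case (elim \<xi>)
    have "stabilizer \<gamma> (\<Phi> \<xi>) = {g. \<forall>n::nat. cmod (\<Phi> \<xi> (\<gamma> g (a n)) - \<Phi> \<xi> (a n)) = 0}"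
      by (rule stabilizer_eq_common_zeros[OF st[OF elim(1)] aut a])
    with elim show ?case by simp
  qed
qed

text \<open>The functional \<open>\<phi>\<close> does not change when a section is set to zero on the null set where \<open>g\<close>
  may fail to fix \<open>\<Phi> \<xi>\<close>. After this modification the two integrands agree at every point rather
  than almost everywhere, so their integrals are equal by congruence.\<close>

lemma AE_stabilizer_imp_tensor_stabilizer:
  fixes \<gamma> :: "'g \<Rightarrow> 'a::{unital_cstar_algebra, second_countable_topology} \<Rightarrow> 'a"
  assumes aut: "star_automorphism (\<gamma> g)" and ts: "tensor_state \<nu> \<phi>"
    and field: "measurable_field_of_states \<nu> \<Phi>" and dec: "decomposes \<nu> \<phi> \<Phi>"
    and fixed: "AE \<xi> in \<nu>. g \<in> stabilizer \<gamma> (\<Phi> \<xi>)"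
  shows "g \<in> tensor_stabilizer \<nu> \<gamma> \<phi>"
proof -
  obtain N where N: "N \<in> null_sets \<nu>" "{\<xi>\<in>space \<nu>. g \<notin> stabilizer \<gamma> (\<Phi> \<xi>)} \<subseteq> N"
    using fixed by (auto simp: eventually_ae_filter)
  define S where "S = space \<nu> - N"
  have S: "S \<in> sets \<nu>" using N by (auto simp: S_def)
  have AE_S: "AE \<xi> in \<nu>. \<xi> \<in> S"
    using AE_not_in[OF N(1)] AE_space by eventually_elim (simp add: S_def)
  have "\<phi> (lift_gauge \<gamma> g A) = \<phi> A" if A: "A \<in> tensor_Linf \<nu>" for A
  proof -
    define A' where "A' \<xi> = indicat_real S \<xi> *\<^sub>R A \<xi>" for \<xi>
    have eq: "AE \<xi> in \<nu>. A' \<xi> = A \<xi>" using AE_S by eventually_elim (simp add: A'_def)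
    have "A \<in> borel_measurable \<nu>" using A by (simp add: tensor_Linf_def Linf_def)
    then have "A' \<in> borel_measurable \<nu>" unfolding A'_def using S by measurable
    then have A': "A' \<in> tensor_Linf \<nu>" by (rule tensor_Linf_AE_cong[OF A _ eq])
    have respects: "\<phi> X = \<phi> Y"
      if "X \<in> tensor_Linf \<nu>" "Y \<in> tensor_Linf \<nu>" "AE \<xi> in \<nu>. X \<xi> = Y \<xi>" for X Y
      using conjunct1[OF ts[unfolded tensor_state_def]] that by blast
    have lift: "lift_gauge \<gamma> g X \<in> tensor_Linf \<nu>" if "X \<in> tensor_Linf \<nu>" for X
      by (rule tensor_Linf_lift_gauge[of \<gamma> g, OF aut that])
    have integral: "\<phi> X = (\<integral>\<xi>. \<Phi> \<xi> (X \<xi>) \<partial>\<nu>)" if "X \<in> tensor_Linf \<nu>" for X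
      using dec that unfolding decomposes_def by (rule bspec)
    have "\<phi> (lift_gauge \<gamma> g A) = \<phi> (lift_gauge \<gamma> g A')"
    proof (rule respects[OF lift[OF A] lift[OF A']])
      show "AE \<xi> in \<nu>. lift_gauge \<gamma> g A \<xi> = lift_gauge \<gamma> g A' \<xi>"
        using eq by eventually_elim (simp add: lift_gauge_def)
    qed
    also have "\<dots> = (\<integral>\<xi>. \<Phi> \<xi> (\<gamma> g (A' \<xi>)) \<partial>\<nu>)"
      using integral[OF lift[OF A']] unfolding lift_gauge_def .
    also have "\<dots> = (\<integral>\<xi>. \<Phi> \<xi> (A' \<xi>) \<partial>\<nu>)"
    proof (rule Bochner_Integration.integral_cong[OF refl])
      fix \<xi> assume \<xi>: "\<xi> \<in> space \<nu>"
      show "\<Phi> \<xi> (\<gamma> g (A' \<xi>)) = \<Phi> \<xi> (A' \<xi>)"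
      proof (cases "\<xi> \<in> S")
        case True
        then have "\<Phi> \<xi> \<circ> \<gamma> g = \<Phi> \<xi>" using N(2) by (auto simp: S_def stabilizer_def)
        then show ?thesis by (metis comp_apply)
      next
        case False
        then have "A' \<xi> = 0" by (simp add: A'_def)
        then show ?thesis using star_automorphism_scaleR[OF aut, of 0 0] by simp
      qed
    qed
    also have "\<dots> = \<phi> A'" by (rule integral[OF A', symmetric])
    also have "\<dots> = \<phi> A" by (rule respects[OF A' A eq])
    finally show ?thesis .
  qed
  then show ?thesis unfolding tensor_stabilizer_def by blast
qed

theorem theorem4p3:
  fixes \<gamma> :: "'g::{topological_group_add, t2_space, second_countable_topology}
                \<Rightarrow> 'a::{unital_cstar_algebra, second_countable_topology} \<Rightarrow> 'a"
    and \<alpha> :: "int ^ 'd \<Rightarrow> 'a \<Rightarrow> 'a"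
    and \<nu> :: "'x::t2_space measure"
    and T :: "int ^ 'd \<Rightarrow> 'x \<Rightarrow> 'x"
    and \<phi> :: "('x \<Rightarrow> 'a) \<Rightarrow> complex"
    and \<Phi> :: "'x \<Rightarrow> 'a \<Rightarrow> complex"
  assumes "compact (UNIV :: 'g set)"
    and "automorphic_action \<gamma>"
    and "\<And>a. continuous_on UNIV (\<lambda>g. \<gamma> g a)"
    and "automorphic_action \<alpha>"
    and "\<And>x g. \<alpha> x \<circ> \<gamma> g = \<gamma> g \<circ> \<alpha> x"
    and "compact (UNIV :: 'x set)"
    and "separable_space (euclidean :: 'x topology)"
    and "sets \<nu> = sets borel"
    and "standard_borel \<nu>"
    and "prob_space \<nu>"
    and "ergodic_action \<nu> T"
    and "\<phi> \<in> invariant_normal_states \<nu> \<alpha> T"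
    and "measurable_field_of_states \<nu> \<Phi>"
    and "decomposes \<nu> \<phi> \<Phi>"
    and "equivariant_field \<nu> \<alpha> T \<Phi>"
  shows "\<exists>F\<in>sets \<nu>. measure \<nu> F = 1 \<and>
           (\<forall>\<xi>\<in>F. stabilizer \<gamma> (\<Phi> \<xi>) = tensor_stabilizer \<nu> \<gamma> \<phi>)"
proof -
  interpret prob_space \<nu> by fact
  have aut_\<gamma>: "star_automorphism (\<gamma> g)" for g
    using assms(2) by (simp add: automorphic_action_def)
  have "surj (\<alpha> x)" for x
    using assms(4) by (simp add: automorphic_action_def star_automorphism_def bij_is_surj)
  then obtain H where H: "AE \<xi> in \<nu>. stabilizer \<gamma> (\<Phi> \<xi>) = H"
    using AE_constant_stabilizer[OF assms(1) aut_\<gamma> assms(3) _ assms(5) assms(10,11,13,15)] by blast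
  have "H = tensor_stabilizer \<nu> \<gamma> \<phi>"
  proof (intro set_eqI iffI)
    fix g assume "g \<in> H"
    from H have "AE \<xi> in \<nu>. g \<in> stabilizer \<gamma> (\<Phi> \<xi>)"
      by eventually_elim (simp add: \<open>g \<in> H\<close>)
    moreover have "tensor_state \<nu> \<phi>"
      using assms(12) unfolding invariant_normal_states_def by blast
    ultimately show "g \<in> tensor_stabilizer \<nu> \<gamma> \<phi>"
      using AE_stabilizer_imp_tensor_stabilizer[where \<gamma> = \<gamma>, OF aut_\<gamma> _ assms(13,14)] by blast
  next
    fix g assume "g \<in> tensor_stabilizer \<nu> \<gamma> \<phi>"
    then have "AE \<xi> in \<nu>. g \<in> stabilizer \<gamma> (\<Phi> \<xi>)"
      by (rule tensor_stabilizer_imp_AE_stabilizer[OF assms(10) aut_\<gamma> assms(13,14)])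
    with H have "AE \<xi> in \<nu>. g \<in> H" by eventually_elim simp
    then show "g \<in> H" by simp
  qed
  with H have "AE \<xi> in \<nu>. stabilizer \<gamma> (\<Phi> \<xi>) = tensor_stabilizer \<nu> \<gamma> \<phi>" by simp
  then obtain F where "F \<in> sets \<nu>" "measure \<nu> F = 1"
    "F \<subseteq> {\<xi>. stabilizer \<gamma> (\<Phi> \<xi>) = tensor_stabilizer \<nu> \<gamma> \<phi>}"
    by (rule AE_E_prob) auto
  then show ?thesis by blast
qed

end
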